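(* Let $G=(V,E)$ be a simple, connected, undirected graph with $m$ edges, let $\tau$ and $\tau_0$ be spanning trees of $G$, both rooted at the same node $r$, and for each $u\neq r$ let $\mathcal{P}_u$ be the path from $u$ to $r$ in $\tau_0$ (directed towards $r$). For $v\neq r$ let $p(v)$ denote the parent of $v$ in $\tau$. Then $$\sum_{u\neq r}\ \sum_{T_1\cup T_2\in\mathbb{F}^{\mathcal{P}_u}(\tau)}\mathrm{vol}(T_1)=\sum_{\substack{v\neq r:\ p(v)\text{ is the parent of }v\text{ in }\tau_0}}\ \sum_{u\in S_1(v)}\big(2m-\mathrm{vol}(Sub(\tau,v))\big),$$ $$\sum_{u\neq r}\ \sum_{T_1\cup T_2\in\mathbb{F}^{\mathcal{P}_u'}(\tau)}\mathrm{vol}(T_1)=\sum_{\substack{v\neq r:\ v\text{ is the parent of }p(v)\text{ in }\tau_0}}\ \sum_{u\in S_2(v)}\big(2m-\mathrm{vol}(Sub(\tau,v))\big),$$ where $S_1(v)=Sub(\tau,v)\cap Sub(\tau_0,v)$ and $S_2(v)=Sub(\tau,v)\cap Sub(\tau_0,p(v))$.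
   Context: $d(v)$ is the degree of $v$ in $G$, $\mathrm{vol}(S)=\sum_{v\in S}d(v)$, and $Sub(\tau,v)$ is the node set of the subtree rooted at $v$ in the tree $\tau$ rooted at $r$. A 2-forest is a spanning forest with exactly two trees, written $T_1\cup T_2$ with $T_1$ the node set of the tree containing $r$. For a simple directed path $\mathcal{P}$ from $u$ to $r$ and spanning tree $\tau$ with $\mathcal{P}^{(\tau)}_{u\to r}$ the unique $u$-to-$r$ path in $\tau$ (edges directed towards $r$): $\mathbb{F}^{\mathcal{P}}(\tau)=\{\tau\setminus\{i,j\}: (i,j)\in\mathcal{P},\ (i,j)\in\mathcal{P}^{(\tau)}_{u\to r}\}$ and $\mathbb{F}^{\mathcal{P}'}(\tau)=\{\tau\setminus\{i,j\}: (i,j)\in\mathcal{P},\ (j,i)\in\mathcal{P}^{(\tau)}_{u\to r}\}$, membership referring to directed edges along the paths. *)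

theory Defs
  imports "Graph_Theory.Digraph_Component"
begin

text \<open>
  A simple undirected graph is a \<^locale>\<open>pair_graph\<close>: a finite, loop-free, symmetric digraph
  without parallel arcs, each undirected edge \<open>{i, j}\<close> being present as the two arcs
  \<open>(i, j)\<close> and \<open>(j, i)\<close>.  The library's \<^const>\<open>forest\<close>, \<^const>\<open>tree\<close> and
  \<^const>\<open>spanning_tree\<close> do not fit this encoding: they forbid every directed cycle, and
  \<open>i, j, i\<close> is one.  Undirected cycles are the library's cycles of length at least 3.
\<close>

definition undirected_tree :: "'a pair_pre_digraph \<Rightarrow> bool" where
  "undirected_tree T \<longleftrightarrow>
     pair_graph T \<and> connected (with_proj T) \<and>
     (\<nexists>c. pre_digraph.cycle (with_proj T) c \<and> 3 \<le> length c)"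

definition undirected_spanning_tree :: "'a pair_pre_digraph \<Rightarrow> 'a pair_pre_digraph \<Rightarrow> bool" where
  "undirected_spanning_tree T G \<longleftrightarrow> undirected_tree T \<and> spanning (with_proj T) (with_proj G)"

definition edge_count :: "'a pair_pre_digraph \<Rightarrow> nat" where
  "edge_count G = card {{i, j} |i j. (i, j) \<in> parcs G}"

definition vol :: "'a pair_pre_digraph \<Rightarrow> 'a set \<Rightarrow> nat" where
  "vol G S = (\<Sum>v\<in>S. out_degree (with_proj G) v)"

text \<open>Paths are lists of arcs, directed from \<open>u\<close> to \<open>v\<close>.\<close>

definition tree_path :: "'a pair_pre_digraph \<Rightarrow> 'a \<Rightarrow> 'a \<Rightarrow> ('a \<times> 'a) awalk" where
  "tree_path T u v = (THE p. pre_digraph.apath (with_proj T) u p v)"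

text \<open>In \<open>is_parent T r w v\<close>, \<open>w\<close> is the parent of \<open>v\<close>. No node is the parent of \<open>r\<close>.\<close>

definition is_parent :: "'a pair_pre_digraph \<Rightarrow> 'a \<Rightarrow> 'a \<Rightarrow> 'a \<Rightarrow> bool" where
  "is_parent T r w v \<longleftrightarrow> (\<exists>p. pre_digraph.apath (with_proj T) v ((v, w) # p) r)"

definition parent :: "'a pair_pre_digraph \<Rightarrow> 'a \<Rightarrow> 'a \<Rightarrow> 'a" where
  "parent T r v = (THE w. is_parent T r w v)"

definition Sub :: "'a pair_pre_digraph \<Rightarrow> 'a \<Rightarrow> 'a \<Rightarrow> 'a set" where
  "Sub T r v = {u \<in> pverts T. v \<in> set (pawalk_verts u (tree_path T u r))}"

definition del_edge :: "'a pair_pre_digraph \<Rightarrow> 'a \<Rightarrow> 'a \<Rightarrow> 'a pair_pre_digraph" where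
  "del_edge T i j = \<lparr>pverts = pverts T, parcs = parcs T - {(i, j), (j, i)}\<rparr>"

text \<open>For \<open>P\<close> a directed path from \<open>u\<close> to \<open>r\<close>, these are the sets of 2-forests
  \<open>\<bbbF>\<^sup>P(T)\<close> and \<open>\<bbbF>\<^sup>P\<^sup>'(T)\<close>.\<close>

definition forests_same ::
    "'a pair_pre_digraph \<Rightarrow> 'a \<Rightarrow> 'a \<Rightarrow> ('a \<times> 'a) awalk \<Rightarrow> 'a pair_pre_digraph set" where
  "forests_same T r u P =
     {del_edge T i j |i j. (i, j) \<in> set P \<and> (i, j) \<in> set (tree_path T u r)}"

definition forests_opposite ::
    "'a pair_pre_digraph \<Rightarrow> 'a \<Rightarrow> 'a \<Rightarrow> ('a \<times> 'a) awalk \<Rightarrow> 'a pair_pre_digraph set" where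
  "forests_opposite T r u P =
     {del_edge T i j |i j. (i, j) \<in> set P \<and> (j, i) \<in> set (tree_path T u r)}"

text \<open>The node set \<open>T\<^sub>1\<close> of the tree of a forest \<open>F\<close> that contains \<open>r\<close>.\<close>

definition root_part :: "'a pair_pre_digraph \<Rightarrow> 'a \<Rightarrow> 'a set" where
  "root_part F r = {v. r \<rightarrow>\<^sup>*\<^bsub>with_proj F\<^esub> v}"

end

theory Submission
  imports Defs
begin

text \<open>
  Deleting the edge between \<open>v\<close> and its parent from \<open>\<tau>\<close> leaves the root in the complement
  of \<open>Sub \<tau> r v\<close>, whose volume is \<open>2m - vol (Sub \<tau> r v)\<close>. So the forests obtained from a fixed
  \<open>u\<close> are indexed injectively by the child \<open>v\<close> of the deleted edge, and an arc \<open>(i, j)\<close> lies on the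
  path from \<open>u\<close> to \<open>r\<close> exactly if \<open>u\<close> is in the subtree at \<open>i\<close> and \<open>j\<close> is the parent of \<open>i\<close>.
  Both identities follow by exchanging the order of summation over \<open>u\<close> and \<open>v\<close>.
\<close>

section \<open>Paths and parents in a rooted undirected tree\<close>

locale rooted_undirected_tree = pair_graph T for T :: "'a pair_pre_digraph" +
  fixes r :: 'a
  assumes connected: "connected (with_proj T)"
    and no_long_cycle: "cycle c \<Longrightarrow> length c < 3"
    and root_in_verts: "r \<in> pverts T"
begin

text \<open>Makes the definite description in \<open>tree_path\<close> meaningful. The paths are
  compared arc by arc, up to their first divergence.\<close>

lemma apath_unique:
  assumes "apath u p v" "apath u q v"
  shows "p = q"
  using assms
proof (induction p arbitrary: u q)
  case Nil
  then have "u = v" by (simp add: apath_Nil_iff)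
  with Nil.prems show ?case using apath_nonempty_ends by blast
next
  case (Cons e p')
  obtain a where e: "e = (u, a)" using Cons.prems(1) by (cases e) (auto simp: apath_Cons_iff)
  have "u \<noteq> v" using Cons.prems(1) apath_nonempty_ends by blast
  with Cons.prems(2) obtain b q' where q: "q = (u, b) # q'"
    by (cases q) (auto simp: apath_simps)
  have pa: "(u, a) \<in> parcs T" "apath a p' v" "u \<notin> set (pawalk_verts a p')"
    and qb: "(u, b) \<in> parcs T" "apath b q' v" "u \<notin> set (pawalk_verts b q')"
    using Cons.prems by (auto simp: e q apath_Cons_iff)
  show ?case
  proof (cases "a = b")
    case True
    then show ?thesis using Cons.IH pa qb e q by auto
  next
    case False
    \<comment> \<open>Follow \<open>p'\<close> to \<open>v\<close> and \<open>q'\<close> back; shortened to a path this avoids \<open>u\<close> and closes up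
      through \<open>u\<close> to a cycle of length at least 3.\<close>
    define w where "w = awalk_to_apath (p' @ rev_path q')"
    have rv: "awalk v (rev_path q') b" using qb by (simp add: awalkI_apath)
    have aw: "awalk a (p' @ rev_path q') b"
      using awalk_appendI awalkI_apath[OF pa(2)] rv by blast
    have w: "apath a w b" "set w \<subseteq> set (p' @ rev_path q')"
      unfolding w_def using apath_awalk_to_apath awalk_to_apath_subset aw by blast+
    have "set (pawalk_verts a w) \<subseteq> set (pawalk_verts a (p' @ rev_path q'))"
      using set_awalk_verts[OF aw] set_awalk_verts[OF awalkI_apath[OF w(1)]] w(2) by auto
    also have "\<dots> = set (pawalk_verts a p') \<union> set (pawalk_verts b q')"
      using set_awalk_verts_append[OF awalkI_apath[OF pa(2)] rv]
        awalk_verts_rev_path[OF awalkI_apath[OF qb(2)]] by simp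
    finally have uw: "u \<notin> set (pawalk_verts a w)" using pa qb by blast
    \<comment> \<open>This excludes the closed walk \<open>u, a, u\<close>, which has length 2 and
      is a harmless cycle in this encoding.\<close>
    have "w \<noteq> []" using w(1) False by (auto simp: apath_Nil_iff)
    have bu: "awalk b [(b, u)] u"
      using arcs_symmetric[OF qb(1)] by (auto simp: awalk_simps intro: in_arcsD2)
    have wb: "awalk a (w @ [(b, u)]) u" using awalk_appendI awalkI_apath[OF w(1)] bu by blast
    have "pawalk_verts a (w @ [(b, u)]) = pawalk_verts a w @ [u]"
      using awalk_verts_append[OF wb] by simp
    then have "distinct (tl (pawalk_verts u ((u, a) # w @ [(b, u)])))"
      using uw w(1) by (simp add: apath_def)
    moreover have "awalk u ((u, a) # w @ [(b, u)]) u"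
      using wb pa(1) by (simp add: awalk_Cons_iff del: awalk_append_iff)
    ultimately have "cycle ((u, a) # w @ [(b, u)])" unfolding cycle_def by auto
    then show ?thesis using no_long_cycle \<open>w \<noteq> []\<close> by fastforce
  qed
qed

lemma tree_path_eqI: "apath u p v \<Longrightarrow> tree_path T u v = p"
  unfolding tree_path_def by (blast intro: apath_unique)

lemma apath_tree_path:
  assumes "u \<in> pverts T" "v \<in> pverts T"
  shows "apath u (tree_path T u v) v"
proof -
  have "strongly_connected (with_proj T)"
    using symmetric_connected_imp_strongly_connected[OF sym_arcs connected] .
  with assms have "u \<rightarrow>\<^sup>*\<^bsub>with_proj T\<^esub> v" by (auto simp: strongly_connected_def)
  then obtain p where "apath u p v" using reachable_apath by blast
  then show ?thesis using tree_path_eqI by simp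
qed

text \<open>The tail of a path is again a path, so uniqueness yields the recursion in the last
  claim.\<close>

lemma is_parentD:
  assumes "is_parent T r w v"
  shows "v \<in> pverts T" "w \<in> pverts T" "v \<noteq> r" "(v, w) \<in> parcs T"
    "tree_path T v r = (v, w) # tree_path T w r"
proof -
  obtain p where p: "apath v ((v, w) # p) r" using assms unfolding is_parent_def by blast
  then have a: "(v, w) \<in> parcs T" "apath w p r" by (auto simp: apath_Cons_iff)
  then show "v \<in> pverts T" "w \<in> pverts T" "(v, w) \<in> parcs T"
    by (auto intro: in_arcsD1 in_arcsD2)
  show "v \<noteq> r" using p apath_nonempty_ends by blast
  show "tree_path T v r = (v, w) # tree_path T w r"
    using tree_path_eqI[OF p] tree_path_eqI[OF a(2)] by simp
qed

lemma parent_eqI: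
  assumes "is_parent T r w v"
  shows "parent T r v = w"
  unfolding parent_def
proof (rule the_equality)
  show "is_parent T r w v" by (rule assms)
  show "w' = w" if "is_parent T r w' v" for w'
    using is_parentD(5)[OF that] is_parentD(5)[OF assms] by simp
qed

lemma is_parent_parent:
  assumes "v \<in> pverts T - {r}"
  shows "is_parent T r (parent T r v) v"
proof -
  have p: "apath v (tree_path T v r) r" using apath_tree_path assms root_in_verts by blast
  moreover have "tree_path T v r \<noteq> []" using p assms by (auto simp: apath_Nil_iff)
  ultimately obtain w p' where "tree_path T v r = (v, w) # p'"
    by (cases "tree_path T v r") (auto simp: apath_Cons_iff)
  with p have "is_parent T r w v" unfolding is_parent_def by auto
  then show ?thesis using parent_eqI by simp
qed

text \<open>Each move to a parent shortens the path to \<open>r\<close> by one arc.\<close>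

lemma not_is_parent_both:
  assumes "is_parent T r w v" "is_parent T r v w"
  shows False
proof -
  have "length (tree_path T v r) = length (tree_path T v r) + 2"
    using is_parentD(5)[OF assms(1)] is_parentD(5)[OF assms(2)]
    by (metis add_2_eq_Suc' length_Cons)
  then show False by simp
qed

text \<open>Translates the arc conditions in the forest sets into subtrees and parents. The part of
  the path of \<open>u\<close> after \<open>i\<close> is the path from \<open>i\<close> to
  \<open>r\<close>, so it starts with the arc to the parent of \<open>i\<close>.\<close>

lemma in_tree_path_iff:
  assumes "u \<in> pverts T"
  shows "(i, j) \<in> set (tree_path T u r) \<longleftrightarrow> u \<in> Sub T r i \<and> is_parent T r j i"
proof
  have p: "apath u (tree_path T u r) r" using apath_tree_path assms root_in_verts .
  show "u \<in> Sub T r i \<and> is_parent T r j i" if ij: "(i, j) \<in> set (tree_path T u r)"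
  proof
    show "u \<in> Sub T r i" unfolding Sub_def using assms awalk_verts_arc1[OF ij] by simp
    obtain p1 p2 where "tree_path T u r = p1 @ (i, j) # p2" using split_list[OF ij] by blast
    with p have "apath i ((i, j) # p2) r" by (auto simp: apath_append_iff apath_Cons_iff)
    then show "is_parent T r j i" unfolding is_parent_def by blast
  qed
  show "(i, j) \<in> set (tree_path T u r)" if "u \<in> Sub T r i \<and> is_parent T r j i"
  proof -
    have "i \<in> set (pawalk_verts u (tree_path T u r))" using that by (simp add: Sub_def)
    then obtain q s where qs: "tree_path T u r = q @ s" "awalk u q i" "awalk i s r"
      using awalk_decomp[OF awalkI_apath[OF p]] by blast
    then have "apath i s r" using p by (auto simp: apath_append_iff)
    then have "s = (i, j) # tree_path T j r" using that is_parentD(5) tree_path_eqI by metis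
    then show ?thesis using qs by simp
  qed
qed

section \<open>Subtrees and the deletion of an edge\<close>

lemma root_notin_Sub: "v \<noteq> r \<Longrightarrow> r \<notin> Sub T r v"
  using tree_path_eqI[of r "[]" r] root_in_verts by (simp add: Sub_def apath_Nil_iff)

lemma Sub_subset: "Sub T r v \<subseteq> pverts T"
  by (auto simp: Sub_def)

lemma in_Sub_child_iff:
  assumes "is_parent T r x y"
  shows "y \<in> Sub T r v \<longleftrightarrow> v = y \<or> x \<in> Sub T r v"
  using is_parentD(1,2,5)[OF assms] by (auto simp: Sub_def)

text \<open>If \<open>x\<close> is off the path from \<open>y\<close> to \<open>r\<close>, the arc
  extends that path. Otherwise the piece from \<open>y\<close> to \<open>x\<close> must be the
  single arc \<open>(y, x)\<close> by uniqueness.\<close>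

lemma arc_is_parent:
  assumes "(x, y) \<in> parcs T"
  shows "is_parent T r y x \<or> is_parent T r x y"
proof -
  have y: "y \<in> pverts T" using assms in_arcsD2 by blast
  have p: "apath y (tree_path T y r) r" using apath_tree_path y root_in_verts .
  show ?thesis
  proof (cases "x \<in> set (pawalk_verts y (tree_path T y r))")
    case False
    then have "apath x ((x, y) # tree_path T y r) r" using assms p by (simp add: apath_Cons_iff)
    then show ?thesis unfolding is_parent_def by blast
  next
    case True
    then obtain q s where qs: "tree_path T y r = q @ s" "awalk y q x" "awalk x s r"
      using awalk_decomp[OF awalkI_apath[OF p]] by blast
    then have "apath y q x" using p by (auto simp: apath_append_iff)
    moreover have "apath y [(y, x)] x"
      using arcs_symmetric[OF assms] no_loops' wellformed'
      by (auto simp: apath_simps)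
    ultimately have "q = [(y, x)]" by (rule apath_unique)
    then show ?thesis using qs p unfolding is_parent_def by auto
  qed
qed

text \<open>The deleted edge is the only one between the subtree at \<open>v\<close> and the rest,
  so walks from \<open>r\<close> never enter the subtree. Conversely, a tree path to
  \<open>r\<close> that avoids \<open>v\<close> survives the deletion and can be reversed.\<close>

lemma root_part_del_edge:
  assumes vw: "is_parent T r w v"
  shows "root_part (del_edge T v w) r = pverts T - Sub T r v"
proof (intro equalityI subsetI)
  let ?F = "del_edge T v w"
  interpret F: pair_wf_digraph ?F
    by unfold_locales (auto simp: del_edge_def intro: in_arcsD1 in_arcsD2)
  have symF: "symmetric (with_proj ?F)"
    by (auto simp: symmetric_def sym_def del_edge_def intro: arcs_symmetric)
  fix x
  show "x \<in> pverts T - Sub T r v" if "x \<in> root_part ?F r"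
  proof -
    have "r \<rightarrow>\<^sup>*\<^bsub>with_proj ?F\<^esub> x" using that by (simp add: root_part_def)
    then show ?thesis
    proof (induction rule: F.reachable_induct)
      case base
      show ?case using root_in_verts root_notin_Sub is_parentD(3)[OF vw] by blast
    next
      case (step x y)
      then have xy: "(x, y) \<in> parcs T" "(x, y) \<noteq> (v, w)" "(x, y) \<noteq> (w, v)"
        by (auto simp: del_edge_def)
      have "y \<notin> Sub T r v"
        using arc_is_parent[OF xy(1)]
      proof
        assume "is_parent T r y x"
        then show ?thesis using in_Sub_child_iff step.IH by blast
      next
        assume a: "is_parent T r x y"
        \<comment> \<open>If \<open>y\<close> were \<open>v\<close>, then \<open>x\<close> would be
          its parent \<open>w\<close>, and the arc would be the deleted
          \<open>(w, v)\<close>.\<close>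
        have "v \<noteq> y" using parent_eqI[OF a] parent_eqI[OF vw] xy by auto
        then show ?thesis using in_Sub_child_iff[OF a] step.IH by blast
      qed
      then show ?case using xy in_arcsD2 by blast
    qed
  qed
  show "x \<in> root_part ?F r" if x: "x \<in> pverts T - Sub T r v"
  proof -
    have p: "apath x (tree_path T x r) r" using apath_tree_path x root_in_verts by blast
    have "v \<notin> set (pawalk_verts x (tree_path T x r))" using x by (auto simp: Sub_def)
    then have "(v, w) \<notin> set (tree_path T x r)" "(w, v) \<notin> set (tree_path T x r)"
      using set_awalk_verts[OF awalkI_apath[OF p]] by force+
    then have "F.awalk x (tree_path T x r) r"
      using awalkI_apath[OF p] unfolding F.awalk_def awalk_def by (auto simp: del_edge_def)
    then have "x \<rightarrow>\<^sup>*\<^bsub>with_proj ?F\<^esub> r" by (rule F.reachable_awalkI)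
    then show ?thesis using symmetric_reachable[OF symF] by (simp add: root_part_def)
  qed
qed

text \<open>Lets a sum over a set of forests be reindexed by children. The missing edge determines
  its ends, and only one of them is the child of the other.\<close>

lemma inj_on_del_edge_parent: "inj_on (\<lambda>v. del_edge T v (parent T r v)) (pverts T - {r})"
proof (rule inj_onI)
  fix v w
  assume v: "v \<in> pverts T - {r}" and w: "w \<in> pverts T - {r}"
    and eq: "del_edge T v (parent T r v) = del_edge T w (parent T r w)"
  note pv = is_parent_parent[OF v] and pw = is_parent_parent[OF w]
  have "(v, parent T r v) \<in> parcs T" using is_parentD(4)[OF pv] .
  moreover have "(v, parent T r v) \<notin> parcs (del_edge T w (parent T r w))"
    unfolding eq[symmetric] by (simp add: del_edge_def)
  ultimately consider "v = w" | "v = parent T r w" "parent T r v = w"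
    by (auto simp: del_edge_def)
  then show "v = w" using not_is_parent_both pv pw by cases metis+
qed

end

lemma rooted_undirected_treeI:
  assumes "undirected_spanning_tree T G" "r \<in> pverts G"
  shows "rooted_undirected_tree T r" "pverts T = pverts G"
  using assms
  by (auto simp: undirected_spanning_tree_def undirected_tree_def spanning_def not_le
      rooted_undirected_tree_def rooted_undirected_tree_axioms_def)

section \<open>Volumes and the handshake identity\<close>

context pair_graph
begin

text \<open>Out-degrees count the arcs by their tails. Forgetting directions is two-to-one, as there
  are no loops.\<close>

lemma vol_verts: "vol G (pverts G) = 2 * edge_count G"
proof -
  let ?E = "(\<lambda>a. {fst a, snd a}) ` parcs G"
  have "fst ` parcs G \<subseteq> pverts G" using arc_fst_in_verts by blast
  then have "vol G (pverts G) = card (parcs G)"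
    using sum.group[OF pair_finite_arcs pair_finite_verts, of fst "\<lambda>_. 1::nat"]
    by (simp add: vol_def out_degree_def out_arcs_def)
  also have "\<dots> = (\<Sum>e\<in>?E. card {a \<in> parcs G. {fst a, snd a} = e})"
    using sum.image_gen[OF pair_finite_arcs, of "\<lambda>_. 1::nat" "\<lambda>a. {fst a, snd a}"] by simp
  also have "\<dots> = (\<Sum>e\<in>?E. 2)"
  proof (rule sum.cong[OF refl])
    fix e assume "e \<in> ?E"
    then obtain i j where ij: "e = {i, j}" "(i, j) \<in> parcs G" by auto
    have "{a \<in> parcs G. {fst a, snd a} = e} = {(i, j), (j, i)}"
      using ij arcs_symmetric[OF ij(2)] by (auto simp: doubleton_eq_iff)
    then show "card {a \<in> parcs G. {fst a, snd a} = e} = 2" using no_loops'[OF ij(2)] by simp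
  qed
  also have "?E = {{i, j} |i j. (i, j) \<in> parcs G}" by force
  finally show ?thesis by (simp add: edge_count_def)
qed

text \<open>Stated over \<open>int\<close> to avoid truncated subtraction.\<close>

lemma vol_compl:
  assumes "S \<subseteq> pverts G"
  shows "int (vol G (pverts G - S)) = 2 * int (edge_count G) - int (vol G S)"
proof -
  have "vol G (pverts G) = vol G (pverts G - S) + vol G S"
    unfolding vol_def by (rule sum.subset_diff[OF assms pair_finite_verts])
  then show ?thesis using vol_verts by linarith
qed

end

section \<open>Forests indexed by the child of the deleted edge\<close>

lemma del_edge_commute: "del_edge T i j = del_edge T j i"
  by (simp add: del_edge_def insert_commute)

lemma forests_same_eq:
  assumes "rooted_undirected_tree T r" "rooted_undirected_tree T' r"
    and "u \<in> pverts T" "u \<in> pverts T'"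
  shows "forests_same T r u (tree_path T' u r) = (\<lambda>v. del_edge T v (parent T r v)) `
    {v \<in> {v \<in> pverts T - {r}. is_parent T' r (parent T r v) v}. u \<in> Sub T r v \<inter> Sub T' r v}"
proof -
  interpret T: rooted_undirected_tree T r by fact
  interpret T': rooted_undirected_tree T' r by fact
  have "(i, j) \<in> set (tree_path T' u r) \<and> (i, j) \<in> set (tree_path T u r) \<longleftrightarrow>
      i \<in> {v \<in> {v \<in> pverts T - {r}. is_parent T' r (parent T r v) v}. u \<in> Sub T r v \<inter> Sub T' r v} \<and>
      j = parent T r i" for i j
    using assms(3,4) T.parent_eqI[of j i] T.is_parentD[of j i] T.is_parent_parent[of i]
    by (auto simp: T.in_tree_path_iff T'.in_tree_path_iff)
  then show ?thesis unfolding forests_same_def by auto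
qed

text \<open>For an arc \<open>(i, j)\<close> of the path in \<open>T'\<close>, the child in
  \<open>T\<close> is now \<open>j\<close>, while the child in \<open>T'\<close> is
  \<open>i\<close>, the parent of \<open>j\<close> in \<open>T\<close>. Hence the second subtree is
  rooted at \<open>parent T r v\<close>.\<close>

lemma forests_opposite_eq:
  assumes "rooted_undirected_tree T r" "rooted_undirected_tree T' r"
    and "u \<in> pverts T" "u \<in> pverts T'"
  shows "forests_opposite T r u (tree_path T' u r) = (\<lambda>v. del_edge T v (parent T r v)) `
    {v \<in> {v \<in> pverts T - {r}. is_parent T' r v (parent T r v)}.
      u \<in> Sub T r v \<inter> Sub T' r (parent T r v)}"
proof -
  interpret T: rooted_undirected_tree T r by fact
  interpret T': rooted_undirected_tree T' r by fact
  have "(i, j) \<in> set (tree_path T' u r) \<and> (j, i) \<in> set (tree_path T u r) \<longleftrightarrow>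
      j \<in> {v \<in> {v \<in> pverts T - {r}. is_parent T' r v (parent T r v)}.
        u \<in> Sub T r v \<inter> Sub T' r (parent T r v)} \<and> i = parent T r j" for i j
    using assms(3,4) T.parent_eqI[of i j] T.is_parentD[of i j] T.is_parent_parent[of j]
    by (auto simp: T.in_tree_path_iff T'.in_tree_path_iff)
  then show ?thesis unfolding forests_opposite_def by (auto simp: del_edge_commute)
qed

text \<open>Common form of both identities: \<open>B\<close> holds the admissible children, and
  \<open>S v\<close> the start nodes \<open>u\<close> whose forests include the one cut above
  \<open>v\<close>.\<close>

lemma sum_vol_root_part:
  assumes "pair_graph G" "rooted_undirected_tree T r" "pverts T = pverts G"
    and B: "B \<subseteq> pverts G - {r}" and S: "\<And>v. S v \<subseteq> Sub T r v"
    and \<F>: "\<And>u. u \<in> pverts G - {r} \<Longrightarrow>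
      \<F> u = (\<lambda>v. del_edge T v (parent T r v)) ` {v \<in> B. u \<in> S v}"
  shows "(\<Sum>u\<in>pverts G - {r}. \<Sum>F\<in>\<F> u. int (vol G (root_part F r))) =
    (\<Sum>v\<in>B. \<Sum>u\<in>S v. 2 * int (edge_count G) - int (vol G (Sub T r v)))"
proof -
  interpret G: pair_graph G by fact
  interpret T: rooted_undirected_tree T r by fact
  let ?c = "\<lambda>v. 2 * int (edge_count G) - int (vol G (Sub T r v))"
  have "(\<Sum>F\<in>\<F> u. int (vol G (root_part F r))) = (\<Sum>v | v \<in> B \<and> u \<in> S v. ?c v)"
    if u: "u \<in> pverts G - {r}" for u
  proof -
    have "int (vol G (root_part (del_edge T v (parent T r v)) r)) = ?c v" if "v \<in> B" for v
    proof -
      have "v \<in> pverts T - {r}" using B that assms(3) by auto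
      then have "root_part (del_edge T v (parent T r v)) r = pverts G - Sub T r v"
        using T.root_part_del_edge[OF T.is_parent_parent] assms(3) by simp
      then show ?thesis using G.vol_compl T.Sub_subset assms(3) by simp
    qed
    moreover have "inj_on (\<lambda>v. del_edge T v (parent T r v)) {v \<in> B. u \<in> S v}"
      by (rule inj_on_subset[OF T.inj_on_del_edge_parent]) (use B assms(3) in auto)
    ultimately show ?thesis unfolding \<F>[OF u] by (simp add: sum.reindex)
  qed
  then have "(\<Sum>u\<in>pverts G - {r}. \<Sum>F\<in>\<F> u. int (vol G (root_part F r))) =
      (\<Sum>u\<in>pverts G - {r}. \<Sum>v | v \<in> B \<and> u \<in> S v. ?c v)"
    by (rule sum.cong[OF refl])
  also have "\<dots> = (\<Sum>v\<in>B. \<Sum>u | u \<in> pverts G - {r} \<and> u \<in> S v. ?c v)"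
    using finite_subset[OF B] G.pair_finite_verts by (intro sum.swap_restrict) auto
  also have "\<dots> = (\<Sum>v\<in>B. \<Sum>u\<in>S v. ?c v)"
  proof (rule sum.cong[OF refl])
    fix v assume "v \<in> B"
    \<comment> \<open>As \<open>v\<close> is not \<open>r\<close>, the root lies outside
      \<open>Sub T r v\<close> and so outside \<open>S v\<close>.\<close>
    then have "{u. u \<in> pverts G - {r} \<and> u \<in> S v} = S v"
      using S[of v] B T.Sub_subset[of v] T.root_notin_Sub[of v] assms(3) by auto
    then show "(\<Sum>u | u \<in> pverts G - {r} \<and> u \<in> S v. ?c v) = (\<Sum>u\<in>S v. ?c v)" by simp
  qed
  finally show ?thesis .
qed

theorem mainTheorem4:
  fixes G \<tau> \<tau>\<^sub>0 :: "'a pair_pre_digraph" and r :: 'a and m :: nat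
    and \<P> :: "'a \<Rightarrow> ('a \<times> 'a) awalk" and p :: "'a \<Rightarrow> 'a" and S\<^sub>1 S\<^sub>2 :: "'a \<Rightarrow> 'a set"
  assumes "pair_graph G" and "connected (with_proj G)"
    and "m = edge_count G"
    and "undirected_spanning_tree \<tau> G" and "undirected_spanning_tree \<tau>\<^sub>0 G"
    and "r \<in> pverts G"
  defines "\<P> \<equiv> \<lambda>u. tree_path \<tau>\<^sub>0 u r"
    and "p \<equiv> parent \<tau> r"
    and "S\<^sub>1 \<equiv> \<lambda>v. Sub \<tau> r v \<inter> Sub \<tau>\<^sub>0 r v"
    and "S\<^sub>2 \<equiv> \<lambda>v. Sub \<tau> r v \<inter> Sub \<tau>\<^sub>0 r (p v)"
  shows "(\<Sum>u\<in>pverts G - {r}. \<Sum>F\<in>forests_same \<tau> r u (\<P> u). int (vol G (root_part F r))) =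
         (\<Sum>v\<in>{v \<in> pverts G - {r}. is_parent \<tau>\<^sub>0 r (p v) v}.
            \<Sum>u\<in>S\<^sub>1 v. 2 * int m - int (vol G (Sub \<tau> r v)))
       \<and> (\<Sum>u\<in>pverts G - {r}. \<Sum>F\<in>forests_opposite \<tau> r u (\<P> u). int (vol G (root_part F r))) =
         (\<Sum>v\<in>{v \<in> pverts G - {r}. is_parent \<tau>\<^sub>0 r v (p v)}.
            \<Sum>u\<in>S\<^sub>2 v. 2 * int m - int (vol G (Sub \<tau> r v)))"
proof -
  note \<tau> = rooted_undirected_treeI[OF assms(4,6)] and \<tau>0 = rooted_undirected_treeI[OF assms(5,6)]
  show ?thesis
    unfolding \<P>_def p_def S\<^sub>1_def S\<^sub>2_def \<open>m = edge_count G\<close>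
    \<comment> \<open>Unification with each conjunct supplies \<open>B\<close> and \<open>S\<close>;
      the inclusions and the descriptions of the forest sets remain.\<close>
    by (intro conjI sum_vol_root_part assms \<tau>)
      (auto simp: forests_same_eq[OF \<tau>(1) \<tau>0(1)] forests_opposite_eq[OF \<tau>(1) \<tau>0(1)]
        \<tau>(2) \<tau>0(2))
qed

end
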